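(* For every $a\in(1/2,1]$, $\cosh(2s_0(a))>2a$, equivalently $B(s_0(a))^2>2K(a)^2$; in particular $\sinh r(a)>2K(a)$.
   Context: For $a>1/2$ put $A(s)=\sqrt{a\cosh(2s)+\tfrac12}$, $B(s)=\sqrt{a\cosh(2s)-\tfrac12}$, $K(a)=\sqrt{a^2-\tfrac14}$, and $\varphi(s)=\int_0^s\frac{K(a)}{A(t)^2B(t)}\,dt$. Let $s_0(a)>0$ be the unique positive solution of $\tanh\varphi(s_0)=\frac{B(s_0)K(a)}{a\sinh(2s_0)}$, and let $r(a)>0$ be defined by $\cosh r(a)=A(s_0(a))\cosh\varphi(s_0(a))$. (These are the data of the critical spherical catenoid in the geodesic ball of radius $r(a)$ of $\mathbb{H}^3$.) *)

theory Defs
  imports "HOL-Analysis.Analysis" "HOL-Real_Asymp.Real_Asymp"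
begin

definition cat_A :: "real \<Rightarrow> real \<Rightarrow> real" where
  "cat_A a s = sqrt (a * cosh (2 * s) + 1 / 2)"

definition cat_B :: "real \<Rightarrow> real \<Rightarrow> real" where
  "cat_B a s = sqrt (a * cosh (2 * s) - 1 / 2)"

definition cat_K :: "real \<Rightarrow> real" where
  "cat_K a = sqrt (a\<^sup>2 - 1 / 4)"

text \<open>The interval integral is oriented, so \<open>cat_phi a\<close> is the odd function on the whole line.\<close>

definition cat_phi :: "real \<Rightarrow> real \<Rightarrow> real" where
  "cat_phi a s = (LBINT t=0..s. cat_K a / ((cat_A a t)\<^sup>2 * cat_B a t))"

text \<open>The descriptions \<open>crit_s0\<close> and \<open>crit_r\<close> are shown to be well defined for \<open>a > 1/2\<close> in
  \<open>crit_s0_ex1\<close> and \<open>crit_r_ex1\<close>.\<close>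

definition crit_s0 :: "real \<Rightarrow> real" where
  "crit_s0 a = (THE s. s > 0 \<and> tanh (cat_phi a s) = cat_B a s * cat_K a / (a * sinh (2 * s)))"

definition crit_r :: "real \<Rightarrow> real" where
  "crit_r a = (THE r. r > 0 \<and> cosh r = cat_A a (crit_s0 a) * cosh (cat_phi a (crit_s0 a)))"

lemma cosh_arg_gt:
  assumes "a > 1 / 2" shows "a * cosh (2 * s) > (1 / 2 :: real)"
proof -
  have "a * 1 \<le> a * cosh (2 * s)"
    using assms by (intro mult_left_mono cosh_real_ge_1) auto
  then show ?thesis using assms by linarith
qed

lemma cat_B_pos: "a > 1 / 2 \<Longrightarrow> cat_B a s > 0"
  using cosh_arg_gt[of a s] by (simp add: cat_B_def)

lemma cat_A_gt_1: "a > 1 / 2 \<Longrightarrow> cat_A a s > 1"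
  using cosh_arg_gt[of a s] by (simp add: cat_A_def)

lemma cat_K_pos: "a > 1 / 2 \<Longrightarrow> cat_K a > 0"
  using power_strict_mono[of "1/2" a 2] by (simp add: cat_K_def power2_eq_square)

lemma cat_phi_deriv:
  assumes a: "a > 1 / 2"
  shows "(cat_phi a has_real_derivative cat_K a / ((cat_A a s)\<^sup>2 * cat_B a s)) (at s)"
proof -
  let ?f = "\<lambda>t. cat_K a / ((cat_A a t)\<^sup>2 * cat_B a t)"
  define m where "m = \<bar>s\<bar> + 1"
  have ne: "cat_A a t \<noteq> 0" "cat_B a t \<noteq> 0" for t
    using cat_A_gt_1[OF a, of t] cat_B_pos[OF a, of t] by auto
  have cont: "continuous_on {-m..m} ?f"
    using ne unfolding cat_A_def cat_B_def by (intro continuous_intros) auto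
  have "((\<lambda>u. LBINT y=0..u. ?f y) has_vector_derivative ?f s) (at s within {-m..m})"
    using interval_integral_FTC2[of "-m" 0 m ?f s, OF _ _ cont]
    by (auto simp: m_def zero_ereal_def)
  moreover have "at s within {-m..m} = at s"
    by (rule at_within_interior) (auto simp: m_def)
  ultimately have "((\<lambda>u. LBINT y=0..u. ?f y) has_vector_derivative ?f s) (at s)"
    by (simp only:)
  then show ?thesis
    unfolding has_real_derivative_iff_has_vector_derivative cat_phi_def .
qed

lemma cat_phi_0: "cat_phi a 0 = 0"
  by (simp add: cat_phi_def flip: zero_ereal_def)

lemma cat_phi_strict_mono:
  assumes "a > 1 / 2" "s < t" shows "cat_phi a s < cat_phi a t"
proof (rule DERIV_pos_imp_increasing[OF assms(2)])
  fix x
  have "cat_K a / ((cat_A a x)\<^sup>2 * cat_B a x) > 0"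
    using cat_K_pos[OF assms(1)] cat_A_gt_1[OF assms(1), of x] cat_B_pos[OF assms(1), of x]
    by (intro divide_pos_pos mult_pos_pos zero_less_power) linarith+
  then show "\<exists>y. (cat_phi a has_real_derivative y) (at x) \<and> y > 0"
    using cat_phi_deriv[OF assms(1), of x] by blast
qed

lemma crit_rhs_strict_antimono:
  assumes a: "a > 1 / 2" and "0 < s" "s < t"
  shows "cat_B a t * cat_K a / (a * sinh (2 * t)) < cat_B a s * cat_K a / (a * sinh (2 * s))"
proof -
  define x y where "x = cosh (2 * s)" and "y = cosh (2 * t)"
  have xy: "1 < x" "x < y"
    using assms cosh_real_strict_mono[of 0 "2 * s"] cosh_real_strict_mono[of "2 * s" "2 * t"]
    by (simp_all add: x_def y_def)
  have sh: "sinh (2 * s) > 0" "sinh (2 * t) > 0" using assms by auto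
  have sq: "(sinh (2 * s))\<^sup>2 = x\<^sup>2 - 1" "(sinh (2 * t))\<^sup>2 = y\<^sup>2 - 1"
    by (simp_all add: x_def y_def sinh_square_eq)
  have B2: "(cat_B a s)\<^sup>2 = a * x - 1 / 2" "(cat_B a t)\<^sup>2 = a * y - 1 / 2"
    using cosh_arg_gt[OF a, of s] cosh_arg_gt[OF a, of t] by (simp_all add: cat_B_def x_def y_def)
  have "1 * (x * y + 1) < (2 * a) * (x * y + 1)"
    using a xy mult_strict_mono[of 1 x 1 y] by (intro mult_strict_right_mono) simp_all
  moreover have "(x - 1) * (y - 1) > 0" using xy by simp
  ultimately have "a * (x * y + 1) - (x + y) / 2 > 0"
    by (simp add: algebra_simps)
  moreover have id: "(a * x - 1 / 2) * (y\<^sup>2 - 1) - (a * y - 1 / 2) * (x\<^sup>2 - 1)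
      = (y - x) * (a * (x * y + 1) - (x + y) / 2)"
    by (simp add: field_simps power2_eq_square)
  ultimately have "(y - x) * (a * (x * y + 1) - (x + y) / 2) > 0"
    using xy by simp
  then have "(a * y - 1 / 2) * (x\<^sup>2 - 1) < (a * x - 1 / 2) * (y\<^sup>2 - 1)"
    using id by linarith
  then have "(cat_B a t * sinh (2 * s))\<^sup>2 < (cat_B a s * sinh (2 * t))\<^sup>2"
    by (simp add: power_mult_distrib sq B2)
  then have "cat_B a t * sinh (2 * s) < cat_B a s * sinh (2 * t)"
    by (rule power2_less_imp_less) (use cat_B_pos[OF a, of s] sh in auto)
  then have "cat_B a t / sinh (2 * t) < cat_B a s / sinh (2 * s)"
    using sh by (simp add: pos_divide_less_eq pos_less_divide_eq)
  then have "(cat_K a / a) * (cat_B a t / sinh (2 * t)) < (cat_K a / a) * (cat_B a s / sinh (2 * s))"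
    using cat_K_pos[OF a] a by (intro mult_strict_left_mono) auto
  then show ?thesis by (simp add: mult_ac)
qed

lemma crit_s0_ex1:
  assumes a: "a > 1 / 2"
  shows "\<exists>!s. s > 0 \<and> tanh (cat_phi a s) = cat_B a s * cat_K a / (a * sinh (2 * s))"
proof -
  let ?R = "\<lambda>s. cat_B a s * cat_K a / (a * sinh (2 * s))"
  let ?g = "\<lambda>s. tanh (cat_phi a s) - ?R s"
  have mono: "?g s < ?g t" if "0 < s" "s < t" for s t
    using crit_rhs_strict_antimono[OF a that] cat_phi_strict_mono[OF a that(2)]
    by (simp add: diff_strict_mono tanh_real_less_iff)
  have K: "cat_K a > 0" by (rule cat_K_pos[OF a])
  have pos1: "tanh (cat_phi a 1) > 0"
    using cat_phi_strict_mono[OF a, of 0 1] by (simp add: cat_phi_0)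
  have lim_top: "(?R \<longlongrightarrow> 0) at_top"
  proof -
    have "((\<lambda>s. sqrt (a * cosh (2 * s) - 1 / 2) * k / (a * sinh (2 * s))) \<longlongrightarrow> 0) at_top"
      if "k > 0" for k :: real
      using a that by (simp add: cosh_def sinh_def) real_asymp
    from this[OF K] show ?thesis by (simp add: cat_B_def)
  qed
  have lim_0: "filterlim ?R at_top (at_right 0)"
  proof -
    have 1: "((\<lambda>s. cat_B a s * cat_K a) \<longlongrightarrow> cat_B a 0 * cat_K a) (at_right 0)"
      unfolding cat_B_def by (auto intro!: tendsto_eq_intros)
    have 2: "filterlim (\<lambda>s. inverse (a * sinh (2 * s))) at_top (at_right 0)"
      using a by real_asymp
    have 3: "cat_B a 0 * cat_K a > 0" using cat_B_pos[OF a] K by simp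
    show ?thesis
      using filterlim_tendsto_pos_mult_at_top[OF 1 3 2] by (simp only: divide_inverse)
  qed
  have "eventually (\<lambda>s. ?R s < tanh (cat_phi a 1) \<and> s > 1) at_top"
    using order_tendstoD(2)[OF lim_top pos1] eventually_gt_at_top[of 1] by eventually_elim auto
  then obtain t where t: "?R t < tanh (cat_phi a 1)" "t > 1"
    using eventually_happens'[OF trivial_limit_at_top_linorder] by blast
  have gt: "?g t > 0"
    using t cat_phi_strict_mono[OF a t(2)] tanh_real_less_iff[of "cat_phi a 1" "cat_phi a t"]
    by linarith
  have "eventually (\<lambda>s. ?R s > 1 \<and> s \<in> {0<..<1}) (at_right 0)"
    using lim_0 eventually_at_right_real[of 0 1] unfolding filterlim_at_top_dense
    by (intro eventually_conj) auto
  then obtain s where s: "?R s > 1" "s \<in> {0<..<1}"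
    using eventually_happens'[OF trivial_limit_at_right_real] by blast
  have gs: "?g s < 0"
    using s tanh_real_lt_1[of "cat_phi a s"] by linarith
  have cont: "continuous_on {s..t} ?g"
  proof -
    have "continuous_on {s..t} (cat_phi a)"
      by (meson cat_phi_deriv[OF a] DERIV_isCont continuous_at_imp_continuous_on)
    moreover have "sinh (2 * x) \<noteq> 0" if "x \<in> {s..t}" for x
      using that s by auto
    ultimately show ?thesis unfolding cat_B_def using a cosh_real_nonzero
      by (intro continuous_intros) auto
  qed
  obtain x where x: "s \<le> x" "?g x = 0"
    using IVT'[of ?g s 0 t] gs gt cont s t by force
  show ?thesis
  proof (rule ex1I[of _ x])
    show "x > 0 \<and> tanh (cat_phi a x) = ?R x" using x s by auto
    fix y assume "y > 0 \<and> tanh (cat_phi a y) = ?R y"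
    then show "y = x"
      using mono[of x y] mono[of y x] x s by (cases x y rule: linorder_cases) auto
  qed
qed

lemma crit_s0_props:
  assumes "a > 1 / 2"
  shows "crit_s0 a > 0"
    and "tanh (cat_phi a (crit_s0 a)) =
           cat_B a (crit_s0 a) * cat_K a / (a * sinh (2 * crit_s0 a))"
  using theI'[OF crit_s0_ex1[OF assms]] unfolding crit_s0_def by auto

lemma crit_r_ex1:
  assumes "a > 1 / 2"
  shows "\<exists>!r. r > 0 \<and> cosh r = cat_A a (crit_s0 a) * cosh (cat_phi a (crit_s0 a))"
proof -
  let ?c = "cat_A a (crit_s0 a) * cosh (cat_phi a (crit_s0 a))"
  have "?c > 1"
    using cat_A_gt_1[OF assms] cosh_real_ge_1 by (rule less_1_mult')
  then have "arcosh ?c > 0 \<and> cosh (arcosh ?c) = ?c"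
    by simp
  then show ?thesis
    by (intro ex1I[of _ "arcosh ?c"]) (auto simp: arcosh_cosh_real dest: sym)
qed

lemma crit_r_props:
  assumes "a > 1 / 2"
  shows "crit_r a > 0"
    and "cosh (crit_r a) = cat_A a (crit_s0 a) * cosh (cat_phi a (crit_s0 a))"
  using theI'[OF crit_r_ex1[OF assms]] unfolding crit_r_def by auto

end

theory Submission
  imports Defs
begin

text \<open>
  Both sides of the equation that determines \<open>crit_s0 a\<close> are monotone, in opposite directions, so
  \<open>cosh (2 * crit_s0 a) > 2 * a\<close> amounts to comparing the two sides at the single point \<open>s1 > 0\<close>
  with \<open>cosh (2 * s1) = 2 * a\<close>.  There \<open>sinh (2 * s1) = 2 * K\<close> and \<open>B\<^sup>2 = 2 * K\<^sup>2\<close>, so the right-hand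
  side is \<open>K / (sqrt 2 * a)\<close>.  The half-angle formulas give \<open>cosh s1 = sqrt (a + 1/2)\<close> and
  \<open>sinh s1 = sqrt (a - 1/2)\<close>, with product \<open>K\<close>.  The integrand of \<open>\<phi>\<close> is largest at \<open>0\<close>, where it
  equals \<open>1 / sqrt (a + 1/2)\<close> (\<open>cat_phi_le\<close>).  Hence
  \<open>tanh \<phi>(s1) \<le> \<phi>(s1) \<le> s1 / cosh s1 \<le> sinh s1 / cosh s1 = K / (a + 1/2)\<close>,
  and this is below \<open>K / (sqrt 2 * a)\<close> as long as \<open>sqrt 2 * a < a + 1/2\<close>, that is
  \<open>a < (sqrt 2 + 1) / 2\<close>; this covers \<open>a \<le> 1\<close>.

  For the radius, the critical equation eliminates \<open>\<phi>\<close> from \<open>cosh r = A * cosh \<phi>\<close> and leaves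
  \<open>sinh\<^sup>2 r = b\<^sup>2 / (b - K\<^sup>2)\<close> with \<open>b = B\<^sup>2\<close> (\<open>sinh_crit_r_square\<close>).  As a function of \<open>b\<close> this has
  its minimum \<open>4 * K\<^sup>2\<close> at \<open>b = 2 * K\<^sup>2\<close> only, and the first part says \<open>b > 2 * K\<^sup>2\<close>.
\<close>

lemma cat_A_square: "a > 1 / 2 \<Longrightarrow> (cat_A a s)\<^sup>2 = a * cosh (2 * s) + 1 / 2"
  using cosh_arg_gt[of a s] by (simp add: cat_A_def)

lemma cat_B_square: "a > 1 / 2 \<Longrightarrow> (cat_B a s)\<^sup>2 = a * cosh (2 * s) - 1 / 2"
  using cosh_arg_gt[of a s] by (simp add: cat_B_def)

lemma cat_K_square: "a > 1 / 2 \<Longrightarrow> (cat_K a)\<^sup>2 = a\<^sup>2 - 1 / 4"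
  using cat_K_pos[of a] by (simp add: cat_K_def)

lemma cat_K_factor: "cat_K a = sqrt (a + 1 / 2) * sqrt (a - 1 / 2)"
  by (simp add: cat_K_def power2_eq_square algebra_simps flip: real_sqrt_mult)

text \<open>Since \<open>A\<close> and \<open>B\<close> are minimal at \<open>0\<close>, the integrand of \<open>\<phi>\<close> never exceeds its value at \<open>0\<close>,
  in which the factorisation of \<open>K\<close> cancels \<open>B\<close>.\<close>

lemma cat_phi_le:
  assumes a: "a > 1 / 2" and s: "s \<ge> 0"
  shows "cat_phi a s \<le> s / sqrt (a + 1 / 2)"
proof -
  have integrand_le: "cat_K a / ((cat_A a t)\<^sup>2 * cat_B a t) \<le> 1 / sqrt (a + 1 / 2)" for t
  proof -
    have ac: "a \<le> a * cosh (2 * t)"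
      using a mult_left_mono[OF cosh_real_ge_1[of "2 * t"], of a] by simp
    have "a + 1 / 2 \<le> (cat_A a t)\<^sup>2" "sqrt (a - 1 / 2) \<le> cat_B a t"
      using ac a by (simp_all add: cat_A_square cat_B_def)
    then have le: "(a + 1 / 2) * sqrt (a - 1 / 2) \<le> (cat_A a t)\<^sup>2 * cat_B a t"
      using a by (intro mult_mono) auto
    have pos: "(a + 1 / 2) * sqrt (a - 1 / 2) > 0" using a by simp
    have "cat_K a / ((cat_A a t)\<^sup>2 * cat_B a t)
        \<le> cat_K a / ((a + 1 / 2) * sqrt (a - 1 / 2))"
      using le less_imp_le[OF cat_K_pos[OF a]] mult_pos_pos[OF less_le_trans[OF pos le] pos]
      by (rule divide_left_mono)
    also have "\<dots> = sqrt (a + 1 / 2) / (a + 1 / 2)"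
      unfolding cat_K_factor by (rule mult_divide_mult_cancel_right) (use a in simp)
    also have "\<dots> = 1 / sqrt (a + 1 / 2)"
      using a by (simp add: sqrt_divide_self_eq inverse_eq_divide)
    finally show ?thesis .
  qed
  have "cat_phi a s - s / sqrt (a + 1 / 2) \<le> cat_phi a 0 - 0 / sqrt (a + 1 / 2)"
  proof (rule DERIV_nonpos_imp_nonincreasing[OF s])
    fix t
    have "((\<lambda>s. cat_phi a s - s / sqrt (a + 1 / 2)) has_real_derivative
        cat_K a / ((cat_A a t)\<^sup>2 * cat_B a t) - 1 / sqrt (a + 1 / 2)) (at t)"
      by (intro DERIV_diff DERIV_cdivide DERIV_ident cat_phi_deriv[OF a])
    then show "\<exists>y. ((\<lambda>s. cat_phi a s - s / sqrt (a + 1 / 2)) has_real_derivative y) (at t) \<and> y \<le> 0"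
      using integrand_le[of t] by (intro exI conjI) auto
  qed
  then show ?thesis by (simp add: cat_phi_0)
qed

lemma tanh_real_le_self:
  fixes x :: real
  assumes "x \<ge> 0" shows "tanh x \<le> x"
proof -
  have "tanh x - x \<le> tanh 0 - 0"
  proof (rule DERIV_nonpos_imp_nonincreasing[OF assms])
    fix t :: real
    have "((\<lambda>x. tanh x - x) has_real_derivative (1 - (tanh t)\<^sup>2) * 1 - 1) (at t)"
      by (intro derivative_intros) auto
    then show "\<exists>y. ((\<lambda>x. tanh x - x) has_real_derivative y) (at t) \<and> y \<le> 0"
      by (intro exI conjI) auto
  qed
  then show ?thesis by simp
qed

text \<open>If \<open>crit_s0 a \<le> s1\<close>, monotonicity of the two sides of the critical equation turns equality
  at \<open>crit_s0 a\<close> into \<open>tanh \<phi> \<ge> B * K / (a * sinh (2 * s))\<close> at \<open>s1\<close>, where everything is explicit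
  apart from \<open>\<phi>(s1)\<close>, and the bound on \<open>\<phi>\<close> contradicts it.  The last hypothesis is what that
  contradiction costs: it says \<open>K / (a + 1/2) < K / (sqrt 2 * a)\<close>.\<close>

lemma cosh_crit_s0_gt:
  assumes a: "1 / 2 < a" and small: "sqrt 2 * a < a + 1 / 2"
  shows "cosh (2 * crit_s0 a) > 2 * a"
proof (rule ccontr)
  assume "\<not> cosh (2 * crit_s0 a) > 2 * a"
  define s1 where "s1 = arcosh (2 * a) / 2"
  have cosh1: "cosh (2 * s1) = 2 * a" using a by (simp add: s1_def)
  have s1: "s1 > 0" using a by (simp add: s1_def)
  have K: "cat_K a > 0" by (rule cat_K_pos[OF a])
  have "cosh (2 * crit_s0 a) \<le> cosh (2 * s1)"
    using \<open>\<not> cosh (2 * crit_s0 a) > 2 * a\<close> by (simp add: cosh1)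
  then have le: "crit_s0 a \<le> s1"
    using s1 crit_s0_props(1)[OF a] by (subst (asm) cosh_real_nonneg_le_iff) auto
  have "(sinh s1)\<^sup>2 = a - 1 / 2"
    using cosh1 cosh_double[of s1] cosh_square_eq[of s1] by linarith
  then have half: "sinh s1 = sqrt (a - 1 / 2)"
    by (rule real_sqrt_unique[symmetric]) (use s1 in simp)
  have "s1 \<le> sinh s1"
    using real_le_x_sinh[of s1] s1 unfolding sinh_field_def exp_minus by linarith
  have sinh1: "sinh (2 * s1) = 2 * cat_K a"
  proof (rule power2_eq_imp_eq)
    show "(sinh (2 * s1))\<^sup>2 = (2 * cat_K a)\<^sup>2"
      by (simp add: sinh_square_eq cosh1 cat_K_square[OF a] power_mult_distrib)
  qed (use s1 K in auto)
  have B1: "cat_B a s1 = sqrt 2 * cat_K a"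
  proof (rule power2_eq_imp_eq)
    show "(cat_B a s1)\<^sup>2 = (sqrt 2 * cat_K a)\<^sup>2"
      unfolding power_mult_distrib cat_B_square[OF a] cosh1 cat_K_square[OF a]
      by (simp add: power2_eq_square)
  qed (use cat_B_pos[OF a, of s1] K in auto)
  have "tanh (cat_phi a s1) \<le> cat_phi a s1"
    using cat_phi_strict_mono[OF a s1] by (intro tanh_real_le_self) (simp add: cat_phi_0)
  also have "\<dots> \<le> s1 / sqrt (a + 1 / 2)"
    using cat_phi_le[OF a] s1 by simp
  also have "\<dots> \<le> sinh s1 / sqrt (a + 1 / 2)"
    using a \<open>s1 \<le> sinh s1\<close> by (intro divide_right_mono) auto
  also have "\<dots> = cat_K a / (a + 1 / 2)"
  proof -
    have "a + 1 / 2 = sqrt (a + 1 / 2) * sqrt (a + 1 / 2)" "sqrt (a + 1 / 2) \<noteq> 0"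
      using a by auto
    then show ?thesis unfolding half cat_K_factor by (metis mult_divide_mult_cancel_left)
  qed
  also have "\<dots> < cat_K a / (sqrt 2 * a)"
    using a K small by (intro divide_strict_left_mono mult_pos_pos) auto
  also have "\<dots> = cat_B a s1 * cat_K a / (a * sinh (2 * s1))"
  proof -
    have "(sqrt 2 * a) * (sqrt 2 * cat_K a) = a * (2 * cat_K a)" by simp
    moreover have "cat_K a / (sqrt 2 * a)
        = (cat_K a * (sqrt 2 * cat_K a)) / ((sqrt 2 * a) * (sqrt 2 * cat_K a))"
      by (rule mult_divide_mult_cancel_right[symmetric]) (use K in simp)
    ultimately show ?thesis
      by (simp only: B1 sinh1 mult.commute[of "sqrt 2 * cat_K a"])
  qed
  also have "\<dots> \<le> cat_B a (crit_s0 a) * cat_K a / (a * sinh (2 * crit_s0 a))"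
  proof (cases "crit_s0 a = s1")
    case False
    with le have "crit_s0 a < s1" by simp
    from crit_rhs_strict_antimono[OF a crit_s0_props(1)[OF a] this] show ?thesis by (rule less_imp_le)
  qed simp
  also have "\<dots> = tanh (cat_phi a (crit_s0 a))"
    by (rule crit_s0_props(2)[OF a, symmetric])
  also have "\<dots> \<le> tanh (cat_phi a s1)"
    using le cat_phi_strict_mono[OF a, of "crit_s0 a" s1] by (cases "crit_s0 a = s1") auto
  finally show False by simp
qed

lemma cat_B_square_gt_iff:
  assumes a: "1 / 2 < a"
  shows "(cat_B a s)\<^sup>2 > 2 * (cat_K a)\<^sup>2 \<longleftrightarrow> cosh (2 * s) > 2 * a"
proof -
  have "(cat_B a s)\<^sup>2 - 2 * (cat_K a)\<^sup>2 = a * (cosh (2 * s) - 2 * a)"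
    unfolding cat_B_square[OF a] cat_K_square[OF a]
    by (simp add: algebra_simps power2_eq_square)
  moreover have "a * (cosh (2 * s) - 2 * a) > 0 \<longleftrightarrow> cosh (2 * s) > 2 * a"
    using a by (simp add: zero_less_mult_iff)
  ultimately show ?thesis by linarith
qed

text \<open>With \<open>a\<^sup>2 * sinh\<^sup>2 (2 * s) = A\<^sup>2 * B\<^sup>2 - K\<^sup>2\<close> and \<open>A\<^sup>2 = B\<^sup>2 + 1\<close>, the critical equation gives
  \<open>1 - tanh\<^sup>2 \<phi> = A\<^sup>2 * (B\<^sup>2 - K\<^sup>2) / (A\<^sup>2 * B\<^sup>2 - K\<^sup>2)\<close>, and \<open>cosh\<^sup>2 \<phi>\<close> is its reciprocal.  The division
  is cleared in the statement so that it does not depend on the sign of \<open>B\<^sup>2 - K\<^sup>2\<close>.\<close>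

lemma sinh_crit_r_square:
  assumes a: "1 / 2 < a"
  defines "b \<equiv> (cat_B a (crit_s0 a))\<^sup>2" and "k \<equiv> (cat_K a)\<^sup>2"
  shows "(sinh (crit_r a))\<^sup>2 * (b - k) = b\<^sup>2"
proof -
  define s p where "s = crit_s0 a" and "p = cat_phi a s"
  have s: "s > 0" using crit_s0_props(1)[OF a] by (simp add: s_def)
  have A2: "(cat_A a s)\<^sup>2 = b + 1"
    by (simp add: b_def s_def cat_A_square[OF a] cat_B_square[OF a])
  have S2: "(a * sinh (2 * s))\<^sup>2 = b\<^sup>2 + b - k"
    by (simp add: b_def k_def s_def power_mult_distrib sinh_square_eq cat_B_square[OF a]
        cat_K_square[OF a]) (simp add: power2_eq_square field_simps)
  have "tanh p * (a * sinh (2 * s)) = cat_B a s * cat_K a"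
    using crit_s0_props(2)[OF a] a s by (simp add: p_def s_def)
  then have "sinh p * (a * sinh (2 * s)) = cosh p * (cat_B a s * cat_K a)"
    by (simp add: tanh_def field_simps)
  then have "(sinh p * (a * sinh (2 * s)))\<^sup>2 = (cosh p * (cat_B a s * cat_K a))\<^sup>2"
    by (rule arg_cong)
  then have "(sinh p)\<^sup>2 * (b\<^sup>2 + b - k) = (cosh p)\<^sup>2 * (b * k)"
    by (simp only: power_mult_distrib[of "sinh p"] power_mult_distrib[of "cosh p"] S2)
      (simp add: power_mult_distrib b_def k_def s_def)
  then have "(cosh p)\<^sup>2 * (b + 1) * (b - k) = b\<^sup>2 + b - k"
    unfolding sinh_square_eq by (simp add: ring_distribs power2_eq_square[of b])
  moreover have "(cosh (crit_r a))\<^sup>2 = (cosh p)\<^sup>2 * (b + 1)"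
    by (simp add: crit_r_props(2)[OF a] power_mult_distrib A2[unfolded s_def] p_def s_def)
  ultimately have "(cosh (crit_r a))\<^sup>2 * (b - k) = b\<^sup>2 + b - k" by simp
  then show ?thesis by (simp add: sinh_square_eq algebra_simps)
qed

theorem theorem8p17:
  fixes a :: real
  assumes "1 / 2 < a" and "a \<le> 1"
  shows "cosh (2 * crit_s0 a) > 2 * a \<and>
         (cosh (2 * crit_s0 a) > 2 * a \<longleftrightarrow> (cat_B a (crit_s0 a))\<^sup>2 > 2 * (cat_K a)\<^sup>2) \<and>
         sinh (crit_r a) > 2 * cat_K a"
proof -
  have "sqrt 2 < 3 / 2"
    by (rule real_less_lsqrt) (auto simp: power2_eq_square)
  then have "(sqrt 2 - 1) * a < 1 / 2 * 1"
    using assms by (intro mult_less_le_imp_less) auto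
  then have gt: "cosh (2 * crit_s0 a) > 2 * a"
    using assms(1) by (intro cosh_crit_s0_gt) (simp_all add: algebra_simps)
  define b k where "b = (cat_B a (crit_s0 a))\<^sup>2" and "k = (cat_K a)\<^sup>2"
  have bk: "b > 2 * k"
    using gt cat_B_square_gt_iff[OF assms(1)] by (simp add: b_def k_def)
  have k: "k > 0" using cat_K_pos[OF assms(1)] by (simp add: k_def)
  \<comment> \<open>\<open>b\<^sup>2 - 4 * k * (b - k)\<close> is the square of \<open>b - 2 * k\<close>.\<close>
  have "(b - 2 * k)\<^sup>2 > 0" using bk by simp
  then have "4 * k * (b - k) < b\<^sup>2"
    by (simp add: power2_eq_square algebra_simps)
  also have "\<dots> = (sinh (crit_r a))\<^sup>2 * (b - k)"
    using sinh_crit_r_square[OF assms(1)] by (simp add: b_def k_def)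
  finally have "4 * k < (sinh (crit_r a))\<^sup>2"
    using bk k by (simp add: mult_less_cancel_right)
  then have "(2 * cat_K a)\<^sup>2 < (sinh (crit_r a))\<^sup>2"
    by (simp add: k_def power_mult_distrib)
  then have "2 * cat_K a < sinh (crit_r a)"
    by (rule power2_less_imp_less) (use crit_r_props(1)[OF assms(1)] in simp)
  then show ?thesis
    using gt cat_B_square_gt_iff[OF assms(1)] by blast
qed

end
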